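(* Let $u:\mathbf{N}\to\mathbf{N}$ be completely multiplicative. Then the sequence of quantum integers $\{[u(n)]_q\}_{n=1}^\infty$ and the sequence of powers $\{q^{u(n)-1}\}_{n=1}^\infty$ are both solutions of the functional equation $f_{mn}(q)=f_m(q)f_n\left(q^{u(m)}\right)$ for all $m,n\in\mathbf{N}$.
   Context: $\mathbf{N}=\{1,2,3,\dots\}$. A function $u:\mathbf{N}\to\mathbf{N}$ is completely multiplicative if $u(mn)=u(m)u(n)$ for all $m,n$. For a positive integer $n$, the quantum integer $[n]_q$ is the polynomial $1+q+q^2+\cdots+q^{n-1}$. *)

theory Defs
  imports "HOL-Computational_Algebra.Polynomial"
begin

(* The positive integers are the elements n > 0 of type nat. Values of functions and
   sequences at the index 0 are junk and are never constrained. *)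

definition completely_multiplicative :: "(nat \<Rightarrow> nat) \<Rightarrow> bool" where
  "completely_multiplicative u \<longleftrightarrow> (\<forall>m>0. \<forall>n>0. u (m * n) = u m * u n)"

definition quantum_int :: "nat \<Rightarrow> 'a::comm_ring_1 poly" where
  "quantum_int n = (\<Sum>i<n. monom 1 i)"

(* monom 1 k is q^k, so composing p with it gives p(q^k). *)
definition solves_functional_equation ::
    "(nat \<Rightarrow> nat) \<Rightarrow> (nat \<Rightarrow> 'a::comm_ring_1 poly) \<Rightarrow> bool" where
  "solves_functional_equation u f \<longleftrightarrow>
     (\<forall>m>0. \<forall>n>0. f (m * n) = f m * pcompose (f n) (monom 1 (u m)))"

end

theory Submission
  imports Defs
begin

text \<open>Multiplicativity turns both claims into identities in a = \<open>u m\<close> and b =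
  \<open>u n\<close>. For quantum integers it is [ab]_q = [a]_q [b]_{q^a}
  (\<open>quantum_int_mult\<close>): each exponent below ab is uniquely i + aj with i < a and j < b.
  For powers, substitution multiplies exponents (\<open>pcompose_monom_monom\<close>), so it remains
  to check ab - 1 = (a - 1) + a(b - 1).\<close>

lemma pcompose_monom_monom:
  "pcompose (monom 1 i) (monom 1 k) = (monom 1 (k * i) :: 'a::comm_ring_1 poly)"
proof (induction i)
  case 0
  then show ?case by (simp add: pcompose_1)
next
  case (Suc i)
  then show ?case
    by (simp add: monom_Suc pcompose_pCons mult_monom)
qed

lemma quantum_int_Suc: "quantum_int (Suc n) = quantum_int n + monom 1 n"
  by (simp add: quantum_int_def)

lemma quantum_int_add:
  "quantum_int (m + n) = quantum_int m + monom 1 m * (quantum_int n :: 'a::comm_ring_1 poly)"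
proof (induction n)
  case 0
  then show ?case by (simp add: quantum_int_def)
next
  case (Suc n)
  then show ?case
    by (simp add: quantum_int_Suc distrib_left mult_monom add.assoc)
qed

text \<open>The mn exponents split into n consecutive blocks of length m; block j sums to (q^m)^j
  [m]_q, and [m]_q factors out.\<close>

lemma quantum_int_mult:
  "quantum_int (m * n) =
     quantum_int m * pcompose (quantum_int n) (monom 1 m :: 'a::comm_ring_1 poly)"
proof (induction n)
  case 0
  then show ?case by (simp add: quantum_int_def)
next
  case (Suc n)
  \<comment> \<open>Split off the last block of m exponents, starting at mn.\<close>
  have "quantum_int (m * Suc n) =
      quantum_int (m * n) + monom 1 (m * n) * (quantum_int m :: 'a poly)"
    by (metis quantum_int_add mult_Suc_right add.commute)
  with Suc show ?case
    by (simp add: quantum_int_Suc pcompose_add pcompose_monom_monom algebra_simps)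
qed

theorem theorem3:
  fixes u :: "nat \<Rightarrow> nat"
  assumes pos: "\<And>n. n > 0 \<Longrightarrow> u n > 0"
    and mult: "completely_multiplicative u"
  shows "solves_functional_equation u (\<lambda>n. quantum_int (u n) :: 'a::comm_ring_1 poly)
       \<and> solves_functional_equation u (\<lambda>n. monom 1 (u n - 1) :: 'a poly)"
proof -
  have u: "u (m * n) = u m * u n" if "m > 0" "n > 0" for m n
    using mult that by (simp add: completely_multiplicative_def)
  \<comment> \<open>The exponent identity for the powers; subtraction on \<open>nat\<close>
    truncates, so positivity of both values is used here.\<close>
  have "u m * u n - 1 = (u m - 1) + u m * (u n - 1)" if "m > 0" "n > 0" for m n
    using pos[OF that(1)] pos[OF that(2)] by (cases "u n") auto
  then show ?thesis
    by (simp add: solves_functional_equation_def u quantum_int_mult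
        pcompose_monom_monom mult_monom)
qed

end
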